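(* Let $f$ be $\tfrac1\tau$-smooth (with $\tau>0$) and let the $g_i$ be $\mu$-strongly convex (with $\mu>0$). Assume that the sequence $\{\sigma_t\}_{t\ge0}$ generated by Algorithm ADN is bounded above by $\sigma_{\sup}$. Let $c_A:=\max_k\|A_{[k]}\|^2$, $\varepsilon_0:=F(\alpha^{(0)})-F(\alpha^\star)$ and $$C_2:=1-\xi(1-\eta)\frac{\mu\tau}{c_A\sigma_{\sup}+\mu\tau}\in(0,1).$$ Then, for every $\varepsilon>0$, Algorithm ADN reaches a suboptimality $F(\alpha^{(t)})-F(\alpha^\star)\le\varepsilon$ within a total number of $$\frac{1}{\log(\gamma)}\log\Big(\gamma\,\frac{\sigma_{\sup}}{\sigma_0}\Big)+\frac{2}{\log(C_2^{-1})}\log\Big(\frac{\varepsilon_0}{\varepsilon}\Big)$$ iterations.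
   Context: Problem. $A\in\mathbb{R}^{d\times n}$ is a matrix with columns $A_{:,i}$, $f:\mathbb{R}^d\to\mathbb{R}$ is convex and twice differentiable, $g_1,\dots,g_n$ are convex functions of one real variable (values in $\mathbb{R}\cup\{+\infty\}$ allowed), and $F(\alpha):=f(A\alpha)+\sum_{i=1}^n g_i(\alpha_i)$ for $\alpha\in\mathbb{R}^n$; $\alpha^\star$ is a minimizer of $F$. "$f$ is $\tfrac1\tau$-smooth" means that $\nabla f$ is Lipschitz with constant $\tfrac1\tau$ in the Euclidean norm. Partition and model. $\mathcal I_1,\dots,\mathcal I_K$ is a partition of $\{1,\dots,n\}$. For $u\in\mathbb{R}^n$, $u_{[k]}\in\mathbb{R}^n$ agrees with $u$ on coordinates in $\mathcal I_k$ and is zero elsewhere. $A_{[k]}$ is the submatrix of $A$ with columns in $\mathcal I_k$; $\|A_{[k]}\|$ is its spectral norm. $\tilde H(\alpha)\in\mathbb{R}^{n\times n}$ is the block-diagonal matrix whose block indexed by $\mathcal I_k$ is $A_{[k]}^\top\nabla^2 f(A\alpha)A_{[k]}$, $k=1,\dots,K$, all other entries being zero. For $\sigma>0$, $$\mathcal M_\sigma(\Delta\alpha;\alpha):=f(A\alpha)+\nabla f(A\alpha)^\top A\Delta\alpha+\tfrac{\sigma}{2}\Delta\alpha^\top\tilde H(\alpha)\Delta\alpha+\sum_{i=1}^n g_i(\alpha_i+\Delta\alpha_i),$$ $$\mathcal M^{(k)}_\sigma(\Delta\alpha_{[k]};\alpha):=\tfrac1K f(A\alpha)+\nabla f(A\alpha)^\top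 A\Delta\alpha_{[k]}+\tfrac{\sigma}{2}\Delta\alpha_{[k]}^\top\tilde H(\alpha)\Delta\alpha_{[k]}+\sum_{i\in\mathcal I_k}g_i((\alpha+\Delta\alpha_{[k]})_i),$$ so that $\mathcal M_\sigma(\Delta\alpha;\alpha)=\sum_k\mathcal M^{(k)}_\sigma(\Delta\alpha_{[k]};\alpha)$. Algorithm ADN. Inputs: $\alpha^{(0)}\in\mathbb{R}^n$, $\sigma_0>0$, $\gamma>1$, $\zeta>1$, $0<\xi<\tfrac1\zeta$, $\eta\in[0,1)$. For $t=0,1,2,\dots$: (1) for each $k$ obtain $\Delta\alpha_{[k]}$ minimizing $\mathcal M^{(k)}_{\sigma_t}(\cdot;\alpha^{(t)})$ $\eta$-approximately, i.e. the ratio of $\mathcal M^{(k)}_{\sigma_t}(\Delta\alpha_{[k]};\alpha^{(t)})-\mathcal M^{(k)}_{\sigma_t}(\Delta\alpha^\star_{[k]};\alpha^{(t)})$ to $\mathcal M^{(k)}_{\sigma_t}(0;\alpha^{(t)})-\mathcal M^{(k)}_{\sigma_t}(\Delta\alpha^\star_{[k]};\alpha^{(t)})$ is at most $\eta$ (the former is at most $\eta$ times the latter), where $\Delta\alpha^\star_{[k]}$ is a minimizer of $\mathcal M^{(k)}_{\sigma_t}(\cdot;\alpha^{(t)})$; (2) set $\Delta\alpha=\sum_k\Delta\alpha_{[k]}$ and $$\rho_t:=\frac{F(\alpha^{(t)})-F(\alpha^{(t)}+\Delta\alpha)}{F(\alpha^{(t)})-\mathcal M_{\sigma_t}(\Delta\alpha;\alpha^{(t)})};$$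 (3) set $\alpha^{(t+1)}:=\alpha^{(t)}+\Delta\alpha$ if $\rho_t\ge\xi$, and $\alpha^{(t+1)}:=\alpha^{(t)}$ otherwise; (4) set $\sigma_{t+1}:=\sigma_t/\gamma$ if $\rho_t>\zeta$, $\sigma_{t+1}:=\sigma_t$ if $\tfrac1\zeta\le\rho_t\le\zeta$, and $\sigma_{t+1}:=\gamma\sigma_t$ if $\rho_t<\tfrac1\zeta$.
   Formalization: The iteration bound is read as the maximum of 0 and the displayed number, which can be negative when ε exceeds ε₀ (the starting point is then already ε-suboptimal) and is undefined for ε₀ = 0; F(α⁽⁰⁾) is assumed finite so that ε₀ and ρ₀ are defined. *)

theory Defs
  imports "HOL-Analysis.Analysis" "HOL-Library.Disjoint_Sets"
begin

section \<open>Gradients, Hessians, strong convexity\<close>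

definition gradient :: "('a::real_inner \<Rightarrow> real) \<Rightarrow> 'a \<Rightarrow> 'a" where
  "gradient f x = (THE v. GDERIV f x :> v)"

definition twice_differentiable :: "(real^'d \<Rightarrow> real) \<Rightarrow> bool" where
  "twice_differentiable f \<longleftrightarrow>
     (\<forall>x. f differentiable (at x)) \<and> (\<forall>x. gradient f differentiable (at x))"

definition hessian :: "(real^'d \<Rightarrow> real) \<Rightarrow> real^'d \<Rightarrow> real^'d^'d" where
  "hessian f x = jacobian (gradient f) (at x)"

lemma gradient_works:
  fixes f :: "'a::euclidean_space \<Rightarrow> real"
  assumes "f differentiable (at x)"
  shows "GDERIV f x :> gradient f x"
proof -
  from assms obtain f' where f': "(f has_derivative f') (at x)"
    by (auto simp: differentiable_def)
  then have "linear f'"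
    by (rule has_derivative_linear)
  then have "f' h = inner h (adjoint f' 1)" for h
    using adjoint_works[of f' h 1] by simp
  then have "f' = (\<lambda>h. inner h (adjoint f' 1))"
    by blast
  with f' have ex: "GDERIV f x :> adjoint f' 1"
    unfolding gderiv_def by metis
  have unique: "v = w" if "GDERIV f x :> v" "GDERIV f x :> w" for v w
  proof -
    have "(\<lambda>h. inner h v) = (\<lambda>h. inner h w)"
      using that has_derivative_unique unfolding gderiv_def by blast
    then show ?thesis
      by (metis inner_commute vector_eq_rdot)
  qed
  show ?thesis
    unfolding gradient_def by (rule theI[of _ "adjoint f' 1"]) (use ex unique in blast)+
qed

lemma hessian_works:
  assumes "twice_differentiable f"
  shows "(gradient f has_derivative (\<lambda>h. hessian f x *v h)) (at x)"
  using assms jacobian_works unfolding twice_differentiable_def hessian_def by blast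

text \<open>
  Strong convexity of an extended-valued function of one real variable (the value \<open>\<infinity>\<close> is
  allowed, \<open>-\<infinity>\<close> is excluded). No lower semicontinuity is required. For \<open>\<mu> = 0\<close> this is
  ordinary convexity, and \<open>\<mu> \<ge> 0\<close> implies ordinary convexity, see below.
\<close>

definition strongly_convex :: "real \<Rightarrow> (real \<Rightarrow> ereal) \<Rightarrow> bool" where
  "strongly_convex \<mu> g \<longleftrightarrow>
     (\<forall>x. g x \<noteq> -\<infinity>) \<and>
     (\<forall>x y t. 0 \<le> t \<and> t \<le> 1 \<longrightarrow>
        g ((1 - t) * x + t * y) + ereal (\<mu> / 2 * t * (1 - t) * (x - y)\<^sup>2)
          \<le> ereal (1 - t) * g x + ereal t * g y)"

lemma strongly_convex_imp_convex:
  assumes "strongly_convex \<mu> g" and "0 \<le> \<mu>" and "0 \<le> t" and "t \<le> 1"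
  shows "g ((1 - t) * x + t * y) \<le> ereal (1 - t) * g x + ereal t * g y"
proof -
  have "g ((1 - t) * x + t * y)
      \<le> g ((1 - t) * x + t * y) + ereal (\<mu> / 2 * t * (1 - t) * (x - y)\<^sup>2)"
    using assms(2-4) add_left_mono[of 0 "ereal (\<mu> / 2 * t * (1 - t) * (x - y)\<^sup>2)"
        "g ((1 - t) * x + t * y)"] by simp
  also have "\<dots> \<le> ereal (1 - t) * g x + ereal t * g y"
    using assms unfolding strongly_convex_def by blast
  finally show ?thesis .
qed


section \<open>Objective and block model\<close>

definition objective ::
  "(real^'d \<Rightarrow> real) \<Rightarrow> real^'n^'d \<Rightarrow> ('n \<Rightarrow> real \<Rightarrow> ereal) \<Rightarrow> real^'n \<Rightarrow> ereal" where
  "objective f A g \<alpha> = ereal (f (A *v \<alpha>)) + (\<Sum>i\<in>UNIV. g i (\<alpha> $ i))"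

text \<open>
  The blocks are \<open>B k\<close> for \<open>k\<close> in the finite index type \<open>'k\<close>, so that \<open>K = CARD('k)\<close>.
\<close>

definition is_partition :: "('k::finite \<Rightarrow> 'n set) \<Rightarrow> bool" where
  "is_partition B \<longleftrightarrow> inj B \<and> partition_on UNIV (range B)"

text \<open>
  The submatrix of \<open>A\<close> with columns in \<open>S\<close> is kept in the ambient format: the other columns are
  replaced by zero. This does not change its spectral norm, and the Gram-type product
  \<open>A\<^sub>S\<^sup>T H A\<^sub>S\<close> becomes the small matrix placed at rows and columns \<open>S\<close>, with zeros elsewhere.
\<close>

definition submatrix_cols :: "real^'n^'d \<Rightarrow> 'n set \<Rightarrow> real^'n^'d" where
  "submatrix_cols A S = (\<chi> r j. if j \<in> S then A $ r $ j else 0)"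

definition spectral_norm :: "real^'n^'d \<Rightarrow> real" where
  "spectral_norm M = onorm (\<lambda>x. M *v x)"

definition supported_on :: "'n set \<Rightarrow> real^'n \<Rightarrow> bool" where
  "supported_on S u \<longleftrightarrow> (\<forall>i. i \<notin> S \<longrightarrow> u $ i = 0)"

definition block_hessian ::
  "(real^'d \<Rightarrow> real) \<Rightarrow> real^'n^'d \<Rightarrow> ('k::finite \<Rightarrow> 'n set) \<Rightarrow> real^'n \<Rightarrow> real^'n^'n" where
  "block_hessian f A B \<alpha> =
     (\<Sum>k\<in>UNIV. transpose (submatrix_cols A (B k)) ** hessian f (A *v \<alpha>) ** submatrix_cols A (B k))"

definition model ::
  "(real^'d \<Rightarrow> real) \<Rightarrow> real^'n^'d \<Rightarrow> ('n \<Rightarrow> real \<Rightarrow> ereal) \<Rightarrow> ('k::finite \<Rightarrow> 'n set) \<Rightarrow>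
   real \<Rightarrow> real^'n \<Rightarrow> real^'n \<Rightarrow> ereal" where
  "model f A g B \<sigma> u \<alpha> =
     ereal (f (A *v \<alpha>) + inner (gradient f (A *v \<alpha>)) (A *v u)
       + \<sigma> / 2 * inner u (block_hessian f A B \<alpha> *v u))
     + (\<Sum>i\<in>UNIV. g i (\<alpha> $ i + u $ i))"

text \<open>The local model is meant for arguments \<open>u\<close> with \<open>supported_on (B k) u\<close>.\<close>

definition local_model ::
  "(real^'d \<Rightarrow> real) \<Rightarrow> real^'n^'d \<Rightarrow> ('n \<Rightarrow> real \<Rightarrow> ereal) \<Rightarrow> ('k::finite \<Rightarrow> 'n set) \<Rightarrow>
   'k \<Rightarrow> real \<Rightarrow> real^'n \<Rightarrow> real^'n \<Rightarrow> ereal" where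
  "local_model f A g B k \<sigma> u \<alpha> =
     ereal (1 / real CARD('k) * f (A *v \<alpha>) + inner (gradient f (A *v \<alpha>)) (A *v u)
       + \<sigma> / 2 * inner u (block_hessian f A B \<alpha> *v u))
     + (\<Sum>i\<in>B k. g i ((\<alpha> + u) $ i))"

lemma block_hessian_entry:
  fixes B :: "'k::finite \<Rightarrow> 'n::finite set"
  assumes "is_partition B" and "i \<in> B k"
  shows "block_hessian f A B \<alpha> $ i $ j =
    (if j \<in> B k then (transpose A ** hessian f (A *v \<alpha>) ** A) $ i $ j else 0)"
proof -
  let ?H = "hessian f (A *v \<alpha>)"
  have disj: "i \<notin> B l" if "l \<noteq> k" for l
  proof -
    have "B l \<noteq> B k"
      using assms(1) that by (auto simp: is_partition_def dest: injD)
    then have "B l \<inter> B k = {}"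
      using assms(1) unfolding is_partition_def partition_on_def by (auto dest: disjointD)
    then show ?thesis
      using assms(2) by blast
  qed
  have entry: "(transpose (submatrix_cols A S) ** ?H ** submatrix_cols A S) $ i $ j =
      (if i \<in> S \<and> j \<in> S then (transpose A ** ?H ** A) $ i $ j else 0)" for S
    by (auto simp: matrix_matrix_mult_def transpose_def submatrix_cols_def intro!: sum.neutral)
  have "block_hessian f A B \<alpha> $ i $ j =
      (\<Sum>l\<in>UNIV. if i \<in> B l \<and> j \<in> B l then (transpose A ** ?H ** A) $ i $ j else 0)"
    unfolding block_hessian_def by (simp only: sum_component entry)
  also have "\<dots> = (\<Sum>l\<in>UNIV. if l = k then
      (if j \<in> B k then (transpose A ** ?H ** A) $ i $ j else 0) else 0)"
    using disj assms(2) by (intro sum.cong) auto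
  finally show ?thesis
    by simp
qed


section \<open>Algorithm ADN\<close>

text \<open>
  \<open>u\<close> is an \<open>\<eta>\<close>-approximate minimizer of the \<open>k\<close>-th local model. The suboptimality ratio is
  written in multiplied form, which also covers a vanishing denominator. Existence of an exact
  minimizer \<open>v\<close> of the local model is part of the requirement.
\<close>

definition approx_local_minimizer ::
  "(real^'d \<Rightarrow> real) \<Rightarrow> real^'n^'d \<Rightarrow> ('n \<Rightarrow> real \<Rightarrow> ereal) \<Rightarrow> ('k::finite \<Rightarrow> 'n set) \<Rightarrow>
   real \<Rightarrow> 'k \<Rightarrow> real \<Rightarrow> real^'n \<Rightarrow> real^'n \<Rightarrow> bool" where
  "approx_local_minimizer f A g B \<eta> k \<sigma> \<alpha> u \<longleftrightarrow>
     supported_on (B k) u \<and>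
     (\<exists>v. is_arg_min (\<lambda>w. local_model f A g B k \<sigma> w \<alpha>) (supported_on (B k)) v \<and>
          local_model f A g B k \<sigma> u \<alpha> - local_model f A g B k \<sigma> v \<alpha>
            \<le> ereal \<eta> * (local_model f A g B k \<sigma> 0 \<alpha> - local_model f A g B k \<sigma> v \<alpha>))"

text \<open>
  One iteration from \<open>(\<alpha>, \<sigma>)\<close> to \<open>(\<alpha>', \<sigma>')\<close>. If the denominator of \<open>\<rho>\<close> vanishes, the ratio is
  undefined and \<open>\<rho>\<close> is left arbitrary, so that every convention for \<open>0/0\<close> is covered.
\<close>

definition adn_step ::
  "(real^'d \<Rightarrow> real) \<Rightarrow> real^'n^'d \<Rightarrow> ('n \<Rightarrow> real \<Rightarrow> ereal) \<Rightarrow> ('k::finite \<Rightarrow> 'n set) \<Rightarrow>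
   real \<Rightarrow> real \<Rightarrow> real \<Rightarrow> real \<Rightarrow> real^'n \<Rightarrow> real \<Rightarrow> real^'n \<Rightarrow> real \<Rightarrow> bool" where
  "adn_step f A g B \<gamma> \<zeta> \<xi> \<eta> \<alpha> \<sigma> \<alpha>' \<sigma>' \<longleftrightarrow>
     (\<exists>(u :: 'k \<Rightarrow> real^'n) (\<Delta> :: real^'n) (\<rho> :: real).
        (\<forall>k. approx_local_minimizer f A g B \<eta> k \<sigma> \<alpha> (u k)) \<and>
        \<Delta> = (\<Sum>k\<in>UNIV. u k) \<and>
        (objective f A g \<alpha> - model f A g B \<sigma> \<Delta> \<alpha> \<noteq> 0 \<longrightarrow>
           ereal \<rho> = (objective f A g \<alpha> - objective f A g (\<alpha> + \<Delta>))
                     / (objective f A g \<alpha> - model f A g B \<sigma> \<Delta> \<alpha>)) \<and>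
        \<alpha>' = (if \<rho> \<ge> \<xi> then \<alpha> + \<Delta> else \<alpha>) \<and>
        \<sigma>' = (if \<rho> > \<zeta> then \<sigma> / \<gamma> else if 1 / \<zeta> \<le> \<rho> then \<sigma> else \<gamma> * \<sigma>))"

definition adn_run ::
  "(real^'d \<Rightarrow> real) \<Rightarrow> real^'n^'d \<Rightarrow> ('n \<Rightarrow> real \<Rightarrow> ereal) \<Rightarrow> ('k::finite \<Rightarrow> 'n set) \<Rightarrow>
   real \<Rightarrow> real \<Rightarrow> real \<Rightarrow> real \<Rightarrow> (nat \<Rightarrow> real^'n) \<Rightarrow> (nat \<Rightarrow> real) \<Rightarrow> bool" where
  "adn_run f A g B \<gamma> \<zeta> \<xi> \<eta> \<alpha> \<sigma> \<longleftrightarrow>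
     (\<forall>t. adn_step f A g B \<gamma> \<zeta> \<xi> \<eta> (\<alpha> t) (\<sigma> t) (\<alpha> (Suc t)) (\<sigma> (Suc t)))"

definition c_A :: "real^'n^'d \<Rightarrow> ('k::finite \<Rightarrow> 'n set) \<Rightarrow> real" where
  "c_A A B = (MAX k. (spectral_norm (submatrix_cols A (B k)))\<^sup>2)"

end

theory Submission
  imports Defs
begin

text \<open>
  Let \<open>s = \<mu> \<tau> / (c \<sigma> + \<mu> \<tau>)\<close> with \<open>c = c_A A B\<close>. At the point \<open>\<alpha> + s (\<alpha>\<^sup>\<star> - \<alpha>)\<close> the curvature
  term of the model is at most \<open>\<sigma> s\<^sup>2 c / (2 \<tau>)\<close> times the squared distance of \<open>\<alpha>\<close> and \<open>\<alpha>\<^sup>\<star>\<close>, and it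
  is absorbed by the strong convexity of the \<open>g i\<close>; hence the minimum of the model lies at least
  \<open>s (F \<alpha> - F \<alpha>\<^sup>\<star>)\<close> below \<open>F \<alpha>\<close>. As the model is a sum of local models, approximate local
  minimization loses only the factor \<open>1 - \<eta>\<close>, and every accepted step shrinks the suboptimality by
  \<open>C\<^sub>2\<close>. A step that does not shrink it multiplies \<open>\<sigma>\<close> by \<open>\<gamma>\<close>. Since \<open>\<sigma>\<close> is bounded, the number of
  such steps exceeds that of the contracting ones by at most \<open>log\<^sub>\<gamma> (\<sigma>\<^sub>s\<^sub>u\<^sub>p / \<sigma>\<^sub>0)\<close>. A vanishing
  denominator of \<open>\<rho>\<close> forces \<open>\<alpha>\<close> to be optimal already.
\<close>

section \<open>First- and second-order bounds for the smooth part\<close>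

text \<open>Along the line through \<open>x\<close> and \<open>y\<close> this is the tangent
  inequality for a convex function of one real variable, with the tangent taken at parameter 0 and
  evaluated at 1.\<close>

lemma convex_on_gradient_le:
  fixes f :: "'a::euclidean_space \<Rightarrow> real"
  assumes "convex_on UNIV f" and "f differentiable (at x)"
  shows "inner (gradient f x) (y - x) \<le> f y - f x"
proof -
  let ?p = "\<lambda>t::real. x + t *\<^sub>R (y - x)"
  have convex: "convex_on UNIV (f \<circ> ?p)"
  proof (rule convex_onI)
    fix t a b :: real assume "0 < t" "t < 1"
    have "?p ((1 - t) *\<^sub>R a + t *\<^sub>R b) = (1 - t) *\<^sub>R ?p a + t *\<^sub>R ?p b"
      by (simp add: algebra_simps)
    then show "(f \<circ> ?p) ((1 - t) *\<^sub>R a + t *\<^sub>R b) \<le> (1 - t) * (f \<circ> ?p) a + t * (f \<circ> ?p) b"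
      using convex_onD[OF assms(1), of t "?p a" "?p b"] \<open>0 < t\<close> \<open>t < 1\<close> by simp
  qed simp
  have p: "(?p has_derivative (\<lambda>h. h *\<^sub>R (y - x))) (at 0)"
    by (auto intro!: derivative_eq_intros)
  have "(f has_derivative (\<lambda>h. inner h (gradient f x))) (at (?p 0))"
    using gradient_works[OF assms(2)] by (simp add: gderiv_def)
  from has_derivative_compose[OF p this]
  have "((f \<circ> ?p) has_field_derivative inner (y - x) (gradient f x)) (at 0)"
    by (simp add: has_field_derivative_def o_def mult.commute[of _ "inner _ _"])
  from convex_on_imp_above_tangent[OF convex _ _ _ this, of 1]
  show ?thesis by (simp add: inner_commute)
qed

text \<open>Difference quotients of \<open>G\<close> in the direction \<open>h\<close> have norm at
  most \<open>L * norm h\<close>, and this survives in the limit. Applied to the gradient, it turns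
  smoothness of \<open>f\<close> into a pointwise bound on its Hessian.\<close>

lemma has_derivative_lipschitz_bound:
  fixes G :: "'a::real_normed_vector \<Rightarrow> 'b::real_normed_vector"
  assumes "L-lipschitz_on UNIV G" and "(G has_derivative D) (at x)"
  shows "norm (D h) \<le> L * norm h"
proof -
  have p: "((\<lambda>t::real. x + t *\<^sub>R h) has_derivative (\<lambda>s. s *\<^sub>R h)) (at 0)"
    by (auto intro!: derivative_eq_intros)
  have "((\<lambda>t::real. G (x + t *\<^sub>R h)) has_derivative (\<lambda>s. D (s *\<^sub>R h))) (at 0)"
    using has_derivative_compose[OF p] assms(2) by simp
  then have "((\<lambda>t::real. G (x + t *\<^sub>R h)) has_vector_derivative D h) (at 0)"
    using linear_scale[OF has_derivative_linear[OF assms(2)]]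
    by (simp add: has_vector_derivative_def)
  then have "((\<lambda>t. (G (x + t *\<^sub>R h) - G x - t *\<^sub>R D h) /\<^sub>R \<bar>t\<bar>) \<longlongrightarrow> 0) (at 0)"
    by (simp add: has_vector_derivative_def has_derivative_def)
  then have lim: "((\<lambda>t. norm ((G (x + t *\<^sub>R h) - G x - t *\<^sub>R D h) /\<^sub>R \<bar>t\<bar>)) \<longlongrightarrow> 0) (at 0)"
    by (rule tendsto_norm_zero)
  \<comment> \<open>The left side does not depend on \<open>t\<close>, while the right side is the
    normalized remainder and tends to 0; so the left side cannot be positive.\<close>
  have "norm (D h) - L * norm h \<le> norm ((G (x + t *\<^sub>R h) - G x - t *\<^sub>R D h) /\<^sub>R \<bar>t\<bar>)"
    if "t \<noteq> 0" for t :: real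
  proof -
    have "\<bar>t\<bar> * norm (D h) \<le> norm (G (x + t *\<^sub>R h) - G x)
        + norm (G (x + t *\<^sub>R h) - G x - t *\<^sub>R D h)"
      using norm_triangle_ineq4[of "G (x + t *\<^sub>R h) - G x" "G (x + t *\<^sub>R h) - G x - t *\<^sub>R D h"]
      by simp
    moreover have "norm (G (x + t *\<^sub>R h) - G x) \<le> L * (\<bar>t\<bar> * norm h)"
      using lipschitz_onD[OF assms(1), of "x + t *\<^sub>R h" x] by (simp add: dist_norm)
    ultimately have "\<bar>t\<bar> * (norm (D h) - L * norm h)
        \<le> norm (G (x + t *\<^sub>R h) - G x - t *\<^sub>R D h)"
      by (simp add: algebra_simps)
    then show ?thesis
      using that by (simp add: pos_le_divide_eq divide_inverse_commute[symmetric] mult.commute)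
  qed
  then have "norm (D h) - L * norm h \<le> 0"
    by (intro tendsto_lowerbound[OF lim]) (auto simp: eventually_at_filter)
  then show ?thesis by simp
qed

lemma hessian_quadratic_form_le:
  assumes "twice_differentiable f" and "L-lipschitz_on UNIV (gradient f)"
  shows "inner h (hessian f x *v h) \<le> L * (norm h)\<^sup>2"
proof -
  have "inner h (hessian f x *v h) \<le> norm h * norm (hessian f x *v h)"
    by (rule norm_cauchy_schwarz)
  also have "\<dots> \<le> norm h * (L * norm h)"
    by (intro mult_left_mono has_derivative_lipschitz_bound[OF assms(2) hessian_works[OF assms(1)]])
      simp
  finally show ?thesis
    by (simp add: power2_eq_square mult_ac)
qed

section \<open>Blocks of coordinates and the block-diagonal Hessian\<close>

text \<open>For \<open>S = B k\<close> this is the block vector u_[k], kept in the ambient space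
  just as \<open>submatrix_cols\<close> keeps the submatrix, so that the blocks can be added
  directly.\<close>

definition restrict_to :: "'n set \<Rightarrow> real^'n \<Rightarrow> real^'n" where
  "restrict_to S u = (\<chi> i. if i \<in> S then u $ i else 0)"

lemma supported_on_restrict_to [simp]: "supported_on S (restrict_to S u)"
  by (simp add: supported_on_def restrict_to_def)

text \<open>The columns outside \<open>S\<close> are zero, so the product sees only the coordinates
  in \<open>S\<close>. It serves to replace a vector by its block, and to show that a vector living
  on another block is annihilated.\<close>

lemma submatrix_cols_cong:
  assumes "\<And>i. i \<in> S \<Longrightarrow> u $ i = v $ i"
  shows "submatrix_cols A S *v u = submatrix_cols A S *v v"
  using assms by (auto simp: submatrix_cols_def matrix_vector_mult_def vec_eq_iff intro!: sum.cong)

lemma partition_inter_empty: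
  assumes "is_partition B" and "k \<noteq> l"
  shows "B k \<inter> B l = {}"
proof -
  have "B k \<noteq> B l"
    using assms by (auto simp: is_partition_def dest: injD)
  then show ?thesis
    using assms(1) unfolding is_partition_def partition_on_def by (auto dest: disjointD)
qed

lemma sum_partition:
  fixes h :: "'n::finite \<Rightarrow> 'a::comm_monoid_add"
  assumes "is_partition B"
  shows "(\<Sum>i\<in>UNIV. h i) = (\<Sum>k\<in>UNIV. \<Sum>i\<in>B k. h i)"
proof -
  have "(\<Union>k. B k) = UNIV"
    using assms by (simp add: is_partition_def partition_on_def)
  then show ?thesis
    using sum.UNION_disjoint[of UNIV B h] partition_inter_empty[OF assms] by simp
qed

lemma sum_restrict_to:
  fixes u :: "real^'n"
  assumes "is_partition B"
  shows "(\<Sum>k\<in>UNIV. restrict_to (B k) u) = u"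
proof -
  have "(\<Sum>k\<in>UNIV. restrict_to (B k) u $ i) = u $ i" for i
  proof -
    have "(\<Union>k. B k) = UNIV"
      using assms by (simp add: is_partition_def partition_on_def)
    then obtain k where k: "i \<in> B k" by blast
    have "i \<in> B l \<longleftrightarrow> l = k" for l
      using k partition_inter_empty[OF assms, of l k] by auto
    then show ?thesis by (simp add: restrict_to_def)
  qed
  then show ?thesis by (simp add: vec_eq_iff)
qed

lemma sum_supported_nth:
  assumes "is_partition B" and "\<And>l. supported_on (B l) (u l)" and "i \<in> B k"
  shows "(\<Sum>l\<in>UNIV. u l) $ i = u k $ i"
proof -
  have "u l $ i = 0" if "l \<noteq> k" for l
    using assms(2)[of l] assms(3) partition_inter_empty[OF assms(1) that]
    by (auto simp: supported_on_def)
  then have "(\<Sum>l\<in>UNIV. u l $ i) = (\<Sum>l\<in>UNIV. if l = k then u k $ i else 0)"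
    by (intro sum.cong) auto
  then show ?thesis by simp
qed

text \<open>Moving each transposed submatrix to the other side of the inner product reduces the
  block Hessian to the Hessian of \<open>f\<close>, tested at the images of \<open>u\<close> under
  the submatrices.\<close>

lemma block_hessian_quadratic_form:
  fixes A :: "real^'n^'d" and B :: "'k::finite \<Rightarrow> 'n set"
  shows "inner u (block_hessian f A B \<alpha> *v u) =
    (\<Sum>k\<in>UNIV. inner (submatrix_cols A (B k) *v u)
      (hessian f (A *v \<alpha>) *v (submatrix_cols A (B k) *v u)))"
proof -
  have add: "(M + N) *v u = M *v u + N *v u" for M N :: "real^'n^'n"
    by (rule matrix_vector_mult_add_rdistrib)
  have "(\<Sum>k\<in>X. M k) *v u = (\<Sum>k\<in>X. M k *v u)" for M :: "'k \<Rightarrow> real^'n^'n" and X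
    by (induction X rule: infinite_finite_induct) (auto simp: add)
  then have "block_hessian f A B \<alpha> *v u = (\<Sum>k\<in>UNIV. transpose (submatrix_cols A (B k)) *v
      (hessian f (A *v \<alpha>) *v (submatrix_cols A (B k) *v u)))"
    by (simp add: block_hessian_def matrix_vector_mul_assoc matrix_mul_assoc
        del: transpose_matrix_vector)
  moreover have "inner u (transpose M *v w) = inner (M *v u) w" for M :: "real^'n^'d" and w
    using dot_lmul_matrix[of w M u] by (simp add: inner_commute)
  ultimately show ?thesis
    by (simp add: inner_sum_right del: transpose_matrix_vector)
qed

text \<open>There are no cross terms: the submatrix of one block annihilates every vector supported
  on another. This is what makes the model separable over the blocks.\<close>

lemma block_hessian_quadratic_form_sum:
  assumes "is_partition B" and "\<And>k. supported_on (B k) (u k)"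
  shows "inner (\<Sum>k\<in>UNIV. u k) (block_hessian f A B \<alpha> *v (\<Sum>k\<in>UNIV. u k)) =
    (\<Sum>k\<in>UNIV. inner (u k) (block_hessian f A B \<alpha> *v u k))"
proof -
  have eq: "submatrix_cols A (B k) *v (\<Sum>l\<in>UNIV. u l) = submatrix_cols A (B k) *v u k" for k
    by (rule submatrix_cols_cong) (rule sum_supported_nth[OF assms])
  have zero: "submatrix_cols A (B l) *v u k = 0" if "l \<noteq> k" for l k
  proof -
    have "submatrix_cols A (B l) *v u k = submatrix_cols A (B l) *v 0"
      using assms partition_inter_empty[OF assms(1) that]
      by (intro submatrix_cols_cong) (auto simp: supported_on_def)
    then show ?thesis by simp
  qed
  have "inner (u k) (block_hessian f A B \<alpha> *v u k) =
    (\<Sum>l\<in>UNIV. if l = k then inner (submatrix_cols A (B k) *v u k)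
      (hessian f (A *v \<alpha>) *v (submatrix_cols A (B k) *v u k)) else 0)" for k
    unfolding block_hessian_quadratic_form by (intro sum.cong) (auto simp: zero)
  then show ?thesis
    unfolding block_hessian_quadratic_form eq by simp
qed

lemma spectral_norm_le_c_A: "(spectral_norm (submatrix_cols A (B k)))\<^sup>2 \<le> c_A A B"
  unfolding c_A_def by (rule Max_ge) auto

lemma c_A_nonneg: "0 \<le> c_A A B"
  using spectral_norm_le_c_A zero_le_power2 by (rule order_trans[rotated])

text \<open>Each block contributes at most \<open>L * c_A A B\<close> times the squared norm of its
  own piece of \<open>u\<close>. The pieces are orthogonal, so their squared norms add up to that of
  \<open>u\<close> and no factor depending on the number of blocks appears.\<close>

lemma block_hessian_quadratic_form_le:
  assumes "is_partition B" and "twice_differentiable f"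
    and lipschitz: "L-lipschitz_on UNIV (gradient f)"
  shows "inner u (block_hessian f A B \<alpha> *v u) \<le> L * c_A A B * (norm u)\<^sup>2"
proof -
  have L: "0 \<le> L"
    using lipschitz by (rule lipschitz_on_nonneg)
  have block: "(norm (submatrix_cols A (B k) *v u))\<^sup>2 \<le> c_A A B * (norm (restrict_to (B k) u))\<^sup>2" for k
  proof -
    let ?M = "submatrix_cols A (B k)" and ?v = "restrict_to (B k) u"
    have "norm (?M *v u) = norm (?M *v ?v)"
      by (rule arg_cong[OF submatrix_cols_cong]) (simp add: restrict_to_def)
    also have "\<dots> \<le> spectral_norm ?M * norm ?v"
      unfolding spectral_norm_def by (rule onorm) (rule matrix_vector_mul_bounded_linear)
    finally have "(norm (?M *v u))\<^sup>2 \<le> (spectral_norm ?M)\<^sup>2 * (norm ?v)\<^sup>2"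
      by (metis norm_ge_zero power_mono power_mult_distrib)
    also have "\<dots> \<le> c_A A B * (norm ?v)\<^sup>2"
      by (intro mult_right_mono spectral_norm_le_c_A) simp
    finally show ?thesis .
  qed
  have "(norm (restrict_to S u))\<^sup>2 = (\<Sum>i\<in>S. (u $ i)\<^sup>2)" for S
    by (simp add: restrict_to_def norm_vec_def L2_set_def sum_nonneg
        if_distrib[of "\<lambda>x. x\<^sup>2"] if_distrib[of abs] sum.If_cases)
  then have norms: "(\<Sum>k\<in>UNIV. (norm (restrict_to (B k) u))\<^sup>2) = (norm u)\<^sup>2"
    using sum_partition[OF assms(1), of "\<lambda>i. (u $ i)\<^sup>2"]
    by (simp add: norm_vec_def L2_set_def sum_nonneg)
  have "inner u (block_hessian f A B \<alpha> *v u)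
      \<le> (\<Sum>k\<in>UNIV. L * (norm (submatrix_cols A (B k) *v u))\<^sup>2)"
    unfolding block_hessian_quadratic_form
    by (intro sum_mono hessian_quadratic_form_le assms)
  also have "\<dots> \<le> (\<Sum>k\<in>UNIV. L * (c_A A B * (norm (restrict_to (B k) u))\<^sup>2))"
    by (intro sum_mono mult_left_mono block L)
  also have "\<dots> = L * c_A A B * (norm u)\<^sup>2"
    by (simp add: sum_distrib_left[symmetric] norms)
  finally show ?thesis .
qed

section \<open>Separability of the model and finiteness of its values\<close>

text \<open>The shares 1/K of the constant term add up to one, the linear term is additive, the
  curvature has no cross terms, and the \<open>g i\<close> are regrouped by blocks.\<close>

lemma model_eq_sum_local_model:
  fixes B :: "'k::finite \<Rightarrow> 'n::finite set"
  assumes "is_partition B" and "\<And>k. supported_on (B k) (u k)"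
  shows "model f A g B \<sigma> (\<Sum>k\<in>UNIV. u k) \<alpha> = (\<Sum>k\<in>UNIV. local_model f A g B k \<sigma> (u k) \<alpha>)"
proof -
  have g: "(\<Sum>i\<in>UNIV. g i (\<alpha> $ i + (\<Sum>k\<in>UNIV. u k) $ i)) =
      (\<Sum>k\<in>UNIV. \<Sum>i\<in>B k. g i ((\<alpha> + u k) $ i))"
    unfolding sum_partition[OF assms(1)]
    by (intro sum.cong refl) (simp only: sum_supported_nth[OF assms] vector_add_component)
  have "A *v (\<Sum>k\<in>UNIV. u k) = (\<Sum>k\<in>UNIV. A *v u k)"
    by (rule linear_sum) simp
  then have smooth: "f (A *v \<alpha>) + inner (gradient f (A *v \<alpha>)) (A *v (\<Sum>k\<in>UNIV. u k))
      + \<sigma> / 2 * inner (\<Sum>k\<in>UNIV. u k) (block_hessian f A B \<alpha> *v (\<Sum>k\<in>UNIV. u k)) =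
    (\<Sum>k\<in>UNIV. 1 / real CARD('k) * f (A *v \<alpha>) + inner (gradient f (A *v \<alpha>)) (A *v u k)
      + \<sigma> / 2 * inner (u k) (block_hessian f A B \<alpha> *v u k))"
    unfolding block_hessian_quadratic_form_sum[OF assms]
    by (simp add: sum.distrib inner_sum_right sum_distrib_left)
  show ?thesis
    unfolding model_def local_model_def g smooth by (simp add: sum.distrib)
qed

lemma sum_ereal_neq_minfty:
  fixes h :: "'a \<Rightarrow> ereal"
  assumes "\<And>i. i \<in> S \<Longrightarrow> h i \<noteq> -\<infinity>"
  shows "sum h S \<noteq> -\<infinity>"
  using assms by (induction S rule: infinite_finite_induct) auto

lemma strongly_convex_neq_minfty: "strongly_convex \<mu> g \<Longrightarrow> g x \<noteq> -\<infinity>"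
  by (simp add: strongly_convex_def)

text \<open>As no \<open>g i\<close> takes the value -\<infinity>, one infinite term would make the
  whole sum infinite. The real values \<open>p\<close> allow the later estimates to be carried out
  in the reals.\<close>

lemma objective_finiteE:
  assumes "\<And>i. strongly_convex \<mu> (g i)" and "objective f A g x = ereal a"
  obtains p where "\<And>i. g i (x $ i) = ereal (p i)"
proof -
  have "(\<Sum>i\<in>UNIV. g i (x $ i)) \<noteq> \<infinity>"
    using assms(2) by (auto simp: objective_def)
  then have not_infty: "g i (x $ i) \<noteq> \<infinity>" for i
    by (simp add: sum_Pinfty)
  have "g i (x $ i) = ereal (real_of_ereal (g i (x $ i)))" for i
    using not_infty[of i] strongly_convex_neq_minfty[OF assms(1), of i "x $ i"]
    by (cases "g i (x $ i)") auto
  then show ?thesis by (rule that)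
qed

lemma strongly_convex_segment_le:
  assumes "strongly_convex \<mu> g" and "g x = ereal p" and "g y = ereal q" and "0 \<le> t" and "t \<le> 1"
  shows "g (x + t * (y - x)) \<le> ereal ((1 - t) * p + t * q - \<mu> / 2 * t * (1 - t) * (y - x)\<^sup>2)"
proof -
  have "g ((1 - t) * x + t * y) + ereal (\<mu> / 2 * t * (1 - t) * (x - y)\<^sup>2)
      \<le> ereal (1 - t) * g x + ereal t * g y"
    using assms(1,4,5) unfolding strongly_convex_def by blast
  then show ?thesis
    \<comment> \<open>The value \<infinity> is impossible, because the right side of the convexity
      inequality is finite here.\<close>
    by (cases "g (x + t * (y - x))") (auto simp: assms(2,3) algebra_simps power2_commute)
qed

section \<open>Decrease of the model and its approximate minimization\<close>

lemma model_segment_le: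
  fixes f :: "real^'d \<Rightarrow> real" and A :: "real^'n^'d" and B :: "'k::finite \<Rightarrow> 'n set"
  assumes "convex_on UNIV f" and diff: "twice_differentiable f"
    and "\<tau> > 0" and "(1 / \<tau>)-lipschitz_on UNIV (gradient f)"
    and "\<mu> > 0" and convex: "\<And>i. strongly_convex \<mu> (g i)"
    and "is_partition B" and "\<sigma> > 0"
    and a: "objective f A g \<alpha> = ereal a" and b: "objective f A g y = ereal b"
  defines "s \<equiv> \<mu> * \<tau> / (c_A A B * \<sigma> + \<mu> * \<tau>)"
  shows "model f A g B \<sigma> (s *\<^sub>R (y - \<alpha>)) \<alpha> \<le> ereal (a - s * (a - b))"
proof -
  obtain p where p: "\<And>i. g i (\<alpha> $ i) = ereal (p i)"
    using objective_finiteE[OF convex a] by blast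
  obtain q where q: "\<And>i. g i (y $ i) = ereal (q i)"
    using objective_finiteE[OF convex b] by blast
  let ?\<delta> = "y - \<alpha>"
  let ?c = "c_A A B"
  have c: "0 \<le> ?c"
    by (rule c_A_nonneg)
  then have pos: "0 < ?c * \<sigma> + \<mu> * \<tau>"
    using assms by (simp add: add_nonneg_pos)
  then have s: "0 \<le> s" "s \<le> 1"
    using c assms(3,5,8) by (auto simp: s_def)
  \<comment> \<open>This equation determines \<open>s\<close>: it makes the bound on the curvature
    term equal to the strong convexity gain of the \<open>g i\<close>.\<close>
  have cancel: "\<sigma> * s * ?c = \<mu> * \<tau> * (1 - s)"
    using pos by (simp add: s_def field_simps)
  have gradient: "inner (gradient f (A *v \<alpha>)) (A *v ?\<delta>) \<le> f (A *v y) - f (A *v \<alpha>)"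
    using convex_on_gradient_le[OF assms(1), of "A *v \<alpha>" "A *v y"] diff
    by (simp add: twice_differentiable_def matrix_vector_mult_diff_distrib)
  have "inner ?\<delta> (block_hessian f A B \<alpha> *v ?\<delta>) \<le> 1 / \<tau> * ?c * (norm ?\<delta>)\<^sup>2"
    by (intro block_hessian_quadratic_form_le assms)
  then have "\<sigma> / 2 * s\<^sup>2 * inner ?\<delta> (block_hessian f A B \<alpha> *v ?\<delta>)
      \<le> \<sigma> / 2 * s\<^sup>2 * (1 / \<tau> * ?c * (norm ?\<delta>)\<^sup>2)"
    using \<open>\<sigma> > 0\<close> by (intro mult_left_mono) auto
  also have "\<dots> = (\<sigma> * s * ?c) * (s / (2 * \<tau>) * (norm ?\<delta>)\<^sup>2)"
    by (simp add: power2_eq_square)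
  also have "\<dots> = \<mu> / 2 * s * (1 - s) * (norm ?\<delta>)\<^sup>2"
    unfolding cancel using \<open>\<tau> > 0\<close> by (simp add: field_simps)
  finally have curvature: "\<sigma> / 2 * s\<^sup>2 * inner ?\<delta> (block_hessian f A B \<alpha> *v ?\<delta>)
      \<le> \<mu> / 2 * s * (1 - s) * (norm ?\<delta>)\<^sup>2" .
  have smooth: "f (A *v \<alpha>) + inner (gradient f (A *v \<alpha>)) (A *v (s *\<^sub>R ?\<delta>))
      + \<sigma> / 2 * inner (s *\<^sub>R ?\<delta>) (block_hessian f A B \<alpha> *v (s *\<^sub>R ?\<delta>))
    \<le> f (A *v \<alpha>) + s * (f (A *v y) - f (A *v \<alpha>)) + \<mu> / 2 * s * (1 - s) * (norm ?\<delta>)\<^sup>2"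
    using mult_left_mono[OF gradient s(1)] curvature
    by (simp add: matrix_vector_mult_scaleR power2_eq_square mult.assoc)
  have norm_squared: "(norm ?\<delta>)\<^sup>2 = (\<Sum>i\<in>UNIV. (?\<delta> $ i)\<^sup>2)"
    by (simp add: norm_vec_def L2_set_def sum_nonneg)
  have "(\<Sum>i\<in>UNIV. g i (\<alpha> $ i + (s *\<^sub>R ?\<delta>) $ i))
      \<le> (\<Sum>i\<in>UNIV. ereal ((1 - s) * p i + s * q i - \<mu> / 2 * s * (1 - s) * (?\<delta> $ i)\<^sup>2))"
    using strongly_convex_segment_le[OF convex p q s] by (intro sum_mono) simp
  also have "\<dots> = ereal ((1 - s) * sum p UNIV + s * sum q UNIV - \<mu> / 2 * s * (1 - s) * (norm ?\<delta>)\<^sup>2)"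
    by (simp only: sum_ereal sum.distrib sum_subtractf sum_distrib_left[symmetric] norm_squared)
  finally have separable: "(\<Sum>i\<in>UNIV. g i (\<alpha> $ i + (s *\<^sub>R ?\<delta>) $ i))
    \<le> ereal ((1 - s) * sum p UNIV + s * sum q UNIV - \<mu> / 2 * s * (1 - s) * (norm ?\<delta>)\<^sup>2)" .
  have "a = f (A *v \<alpha>) + sum p UNIV" "b = f (A *v y) + sum q UNIV"
    using a b by (simp_all add: objective_def p q)
  \<comment> \<open>The term in the squared norm of \<open>y - \<alpha>\<close> enters the smooth
    part with a plus and the separable part with a minus, and cancels.\<close>
  then have total: "a - s * (a - b) =
      (f (A *v \<alpha>) + s * (f (A *v y) - f (A *v \<alpha>)) + \<mu> / 2 * s * (1 - s) * (norm ?\<delta>)\<^sup>2)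
      + ((1 - s) * sum p UNIV + s * sum q UNIV - \<mu> / 2 * s * (1 - s) * (norm ?\<delta>)\<^sup>2)"
    by (simp add: algebra_simps)
  show ?thesis
    unfolding total model_def
    using add_mono[OF iffD2[OF ereal_less_eq(3) smooth] separable] by (simp only: plus_ereal.simps(1))
qed

text \<open>Any point \<open>w\<close> gives an upper bound \<open>m\<close> for the sum of the
  exact local minima. The ratio condition places each local value below the mean of the local
  minimum and the value at 0 with weights 1 - \<eta> and \<eta>; summing over the blocks preserves
  this.\<close>

lemma model_approx_minimizer:
  fixes B :: "'k::finite \<Rightarrow> 'n::finite set"
  assumes partition: "is_partition B" and convex: "\<And>i. strongly_convex \<mu> (g i)"
    and approx: "\<And>k. approx_local_minimizer f A g B \<eta> k \<sigma> \<alpha> (u k)"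
    and "\<eta> \<le> 1"
    and a: "objective f A g \<alpha> = ereal a" and m: "model f A g B \<sigma> w \<alpha> \<le> ereal m"
  obtains c where "model f A g B \<sigma> (\<Sum>k\<in>UNIV. u k) \<alpha> = ereal c" and "(1 - \<eta>) * (a - m) \<le> a - c"
proof -
  let ?L = "\<lambda>k w. local_model f A g B k \<sigma> w \<alpha>"
  have u: "supported_on (B k) (u k)" for k
    using approx by (simp add: approx_local_minimizer_def)
  have "\<exists>v. \<forall>k. is_arg_min (?L k) (supported_on (B k)) (v k) \<and>
      ?L k (u k) - ?L k (v k) \<le> ereal \<eta> * (?L k 0 - ?L k (v k))"
    using approx unfolding approx_local_minimizer_def by metis
  then obtain v where v: "\<And>k. is_arg_min (?L k) (supported_on (B k)) (v k)"
    and ratio: "\<And>k. ?L k (u k) - ?L k (v k) \<le> ereal \<eta> * (?L k 0 - ?L k (v k))"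
    by blast
  have min: "?L k (v k) \<le> ?L k x" if "supported_on (B k) x" for k x
    using v[of k] that by (auto simp: is_arg_min_def not_less)
  have v_supp: "supported_on (B k) (v k)" for k
    using v[of k] by (simp add: is_arg_min_def)
  have zero: "supported_on S 0" for S :: "'n set"
    by (simp add: supported_on_def)
  have not_minfty: "?L k x \<noteq> -\<infinity>" for k x
    using sum_ereal_neq_minfty[of "B k" "\<lambda>i. g i ((\<alpha> + x) $ i)"] strongly_convex_neq_minfty[OF convex]
    by (auto simp: local_model_def)
  \<comment> \<open>At the zero step the model equals the objective. Its finiteness passes to each
    local model at 0, then to the minima, and through the ratio condition to the approximate
    minimizers.\<close>
  have sum_zero: "(\<Sum>k\<in>UNIV. ?L k 0) = ereal a"
    using model_eq_sum_local_model[OF partition zero, of f A g \<sigma> \<alpha>] a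
    by (simp add: model_def objective_def)
  then have "?L k 0 \<noteq> \<infinity>" for k
    using sum_Pinfty[of "\<lambda>k. ?L k 0" UNIV] by auto
  then have z: "\<exists>z. ?L k 0 = ereal z" for k
    using not_minfty[of k 0] by (cases "?L k 0") auto
  then obtain z where z: "\<And>k. ?L k 0 = ereal (z k)"
    by metis
  have "\<exists>y. ?L k (v k) = ereal y" for k
    using not_minfty[of k "v k"] min[OF zero, of k] z[of k] by (cases "?L k (v k)") auto
  then obtain y where y: "\<And>k. ?L k (v k) = ereal (y k)"
    by metis
  have "\<exists>x. ?L k (u k) = ereal x" for k
    using not_minfty[of k "u k"] ratio[of k] z[of k] y[of k] by (cases "?L k (u k)") auto
  then obtain x where x: "\<And>k. ?L k (u k) = ereal (x k)"
    by metis
  have "x k \<le> (1 - \<eta>) * y k + \<eta> * z k" for k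
    using ratio[of k] by (simp add: x y z algebra_simps)
  then have "sum x UNIV \<le> (\<Sum>k\<in>UNIV. (1 - \<eta>) * y k + \<eta> * z k)"
    by (rule sum_mono)
  also have "\<dots> = (1 - \<eta>) * sum y UNIV + \<eta> * a"
    using sum_zero by (simp add: z sum.distrib sum_distrib_left[symmetric])
  also have "\<dots> \<le> (1 - \<eta>) * m + \<eta> * a"
  proof -
    have "ereal (sum y UNIV) = (\<Sum>k\<in>UNIV. ?L k (v k))"
      by (simp add: y)
    \<comment> \<open>The block of \<open>w\<close> is an admissible competitor in each local
      problem.\<close>
    also have "\<dots> \<le> (\<Sum>k\<in>UNIV. ?L k (restrict_to (B k) w))"
      by (intro sum_mono min) simp
    also have "\<dots> = model f A g B \<sigma> (\<Sum>k\<in>UNIV. restrict_to (B k) w) \<alpha>"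
      by (rule model_eq_sum_local_model[OF partition, symmetric]) simp
    also have "\<dots> \<le> ereal m"
      using m by (simp add: sum_restrict_to[OF partition])
    finally show ?thesis
      using \<open>\<eta> \<le> 1\<close> by (simp add: mult_left_mono)
  qed
  finally have "(1 - \<eta>) * (a - m) \<le> a - sum x UNIV"
    by (simp add: algebra_simps)
  moreover have "model f A g B \<sigma> (\<Sum>k\<in>UNIV. u k) \<alpha> = ereal (sum x UNIV)"
    unfolding model_eq_sum_local_model[OF partition u] x by simp
  ultimately show ?thesis
    using that by blast
qed

section \<open>Effect of a single iteration\<close>

lemma adn_step_progress:
  fixes f :: "real^'d \<Rightarrow> real" and A :: "real^'n^'d" and B :: "'k::finite \<Rightarrow> 'n set"
  assumes "convex_on UNIV f" and "twice_differentiable f"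
    and "\<tau> > 0" and "(1 / \<tau>)-lipschitz_on UNIV (gradient f)"
    and "\<mu> > 0" and convex: "\<And>i. strongly_convex \<mu> (g i)"
    and partition: "is_partition B"
    and parameters: "\<zeta> > 1" "0 < \<xi>" "\<xi> < 1 / \<zeta>" "\<eta> < 1"
    and step: "adn_step f A g B \<gamma> \<zeta> \<xi> \<eta> \<alpha> \<sigma> \<alpha>' \<sigma>'"
    and "\<sigma> > 0" and "\<sigma> \<le> \<sigma>sup"
    and a: "objective f A g \<alpha> = ereal a" and b: "objective f A g y = ereal b" and "b < a"
  obtains a' where "objective f A g \<alpha>' = ereal a'"
    and "\<sigma>' = \<gamma> * \<sigma> \<and> a' \<le> a \<or>
      \<sigma>' \<in> {\<sigma>, \<sigma> / \<gamma>} \<and>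
      a' - b \<le> (1 - \<xi> * (1 - \<eta>) * (\<mu> * \<tau> / (c_A A B * \<sigma>sup + \<mu> * \<tau>))) * (a - b)"
proof -
  let ?s = "\<lambda>\<sigma>. \<mu> * \<tau> / (c_A A B * \<sigma> + \<mu> * \<tau>)"
  obtain u \<Delta> \<rho> where approx: "\<And>k. approx_local_minimizer f A g B \<eta> k \<sigma> \<alpha> (u k)"
    and \<Delta>: "\<Delta> = (\<Sum>k\<in>UNIV. u k)"
    and \<rho>: "objective f A g \<alpha> - model f A g B \<sigma> \<Delta> \<alpha> \<noteq> 0 \<longrightarrow>
           ereal \<rho> = (objective f A g \<alpha> - objective f A g (\<alpha> + \<Delta>))
                     / (objective f A g \<alpha> - model f A g B \<sigma> \<Delta> \<alpha>)"
    and \<alpha>': "\<alpha>' = (if \<rho> \<ge> \<xi> then \<alpha> + \<Delta> else \<alpha>)"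
    and \<sigma>': "\<sigma>' = (if \<rho> > \<zeta> then \<sigma> / \<gamma> else if 1 / \<zeta> \<le> \<rho> then \<sigma> else \<gamma> * \<sigma>)"
    using step unfolding adn_step_def by blast
  have "model f A g B \<sigma> (?s \<sigma> *\<^sub>R (y - \<alpha>)) \<alpha> \<le> ereal (a - ?s \<sigma> * (a - b))"
    by (intro model_segment_le assms)
  from model_approx_minimizer[OF partition convex approx _ a this] parameters(4)
  obtain c where c: "model f A g B \<sigma> \<Delta> \<alpha> = ereal c"
    and decrease: "(1 - \<eta>) * (?s \<sigma> * (a - b)) \<le> a - c"
    unfolding \<Delta> by auto
  have "0 < c_A A B * \<sigma> + \<mu> * \<tau>"
    using c_A_nonneg[of A B] \<open>\<sigma> > 0\<close> \<open>\<mu> > 0\<close> \<open>\<tau> > 0\<close> by (simp add: add_nonneg_pos)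
  moreover have "c_A A B * \<sigma> \<le> c_A A B * \<sigma>sup"
    using c_A_nonneg[of A B] \<open>\<sigma> \<le> \<sigma>sup\<close> by (rule mult_left_mono[rotated])
  ultimately have s: "0 < ?s \<sigma>sup" "?s \<sigma>sup \<le> ?s \<sigma>"
    using \<open>\<mu> > 0\<close> \<open>\<tau> > 0\<close> by (auto intro!: divide_left_mono)
  \<comment> \<open>The step fraction decreases in \<sigma>, so passing to
    \<open>\<sigma>sup\<close> yields a rate independent of the iteration.\<close>
  have "(1 - \<eta>) * (?s \<sigma>sup * (a - b)) \<le> (1 - \<eta>) * (?s \<sigma> * (a - b))"
    using s parameters(4) \<open>b < a\<close> by (intro mult_left_mono mult_right_mono) auto
  with decrease have decrease_sup: "(1 - \<eta>) * (?s \<sigma>sup * (a - b)) \<le> a - c"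
    by linarith
  moreover have "0 < (1 - \<eta>) * (?s \<sigma>sup * (a - b))"
    using s(1) parameters(4) \<open>b < a\<close> by (intro mult_pos_pos) auto
  ultimately have "c < a"
    by linarith
  \<comment> \<open>Strict decrease of the model makes the denominator positive, so \<rho> is the
    genuine ratio and not the arbitrary value.\<close>
  then have \<rho>': "ereal \<rho> = (ereal a - objective f A g (\<alpha> + \<Delta>)) / ereal (a - c)"
    using \<rho> by (simp add: a c)
  \<comment> \<open>An infinite objective at the trial point would make the ratio infinite, but
    \<rho> is real.\<close>
  then obtain e where e: "objective f A g (\<alpha> + \<Delta>) = ereal e"
    using \<open>c < a\<close> by (cases "objective f A g (\<alpha> + \<Delta>)") auto
  have \<rho>_eq: "\<rho> = (a - e) / (a - c)"
    using \<rho>' \<open>c < a\<close> by (simp add: e)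
  have accept: "\<xi> * (a - c) \<le> a - e" if "\<xi> \<le> \<rho>"
    using that \<open>c < a\<close> by (simp add: \<rho>_eq pos_le_divide_eq)
  show ?thesis
  \<comment> \<open>The split is at 1/\<zeta>, not at \<xi>. Below it \<sigma> grows, and the step
    may still be accepted, which only ensures that the objective does not increase. From it on,
    \<xi> < 1/\<zeta> guarantees acceptance and hence contraction.\<close>
  proof (cases "\<rho> < 1 / \<zeta>")
    case True
    moreover have "1 / \<zeta> < \<zeta>"
      using parameters(1) less_trans[of "1 / \<zeta>" 1 \<zeta>] by simp
    ultimately have "\<sigma>' = \<gamma> * \<sigma>"
      by (simp add: \<sigma>')
    moreover have "e \<le> a" if "\<xi> \<le> \<rho>"
      using accept[OF that] parameters(2) \<open>c < a\<close> mult_pos_pos[of \<xi> "a - c"] by linarith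
    ultimately show ?thesis
      using that a e \<alpha>' by (cases "\<xi> \<le> \<rho>") auto
  next
    case False
    then have "\<xi> \<le> \<rho>"
      using parameters(3) by simp
    have "\<xi> * ((1 - \<eta>) * (?s \<sigma>sup * (a - b))) \<le> \<xi> * (a - c)"
      using decrease_sup parameters(2) by (intro mult_left_mono) auto
    with accept[OF \<open>\<xi> \<le> \<rho>\<close>]
    have "e - b \<le> (a - b) - \<xi> * ((1 - \<eta>) * (?s \<sigma>sup * (a - b)))"
      by linarith
    also have "\<dots> = (1 - \<xi> * (1 - \<eta>) * ?s \<sigma>sup) * (a - b)"
      by (simp only: left_diff_distrib mult.assoc mult_1_left)
    finally show ?thesis
      using that e \<open>\<xi> \<le> \<rho>\<close> False by (auto simp: \<alpha>' \<sigma>')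
  qed
qed

section \<open>Counting the contracting iterations\<close>

lemma contraction_count:
  fixes gap \<sigma> :: "nat \<Rightarrow> real"
  assumes "\<gamma> > 1" and "C > 0" and "\<sigma> 0 > 0"
    and step: "\<And>t. t < N \<Longrightarrow> \<sigma> (Suc t) = \<gamma> * \<sigma> t \<and> gap (Suc t) \<le> gap t \<or>
      \<sigma> (Suc t) \<in> {\<sigma> t, \<sigma> t / \<gamma>} \<and> gap (Suc t) \<le> C * gap t"
    and pos: "\<And>t. t \<le> N \<Longrightarrow> \<sigma> t > 0"
  obtains n where "real N \<le> 2 * real n + ln (\<sigma> N / \<sigma> 0) / ln \<gamma>" and "gap N \<le> C ^ n * gap 0"
proof -
  \<comment> \<open>Here \<open>p\<close> counts the steps that multiply \<sigma> by \<gamma> and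
    \<open>n\<close> the contracting ones. A contracting step lowers \<sigma> by a factor of at most
    \<gamma>, which the extra power of \<gamma> on the right compensates.\<close>
  have "\<exists>p n. p + n = t \<and> \<sigma> 0 * \<gamma> ^ p \<le> \<sigma> t * \<gamma> ^ n \<and> gap t \<le> C ^ n * gap 0" if "t \<le> N" for t
    using that
  proof (induction t)
    case 0
    show ?case by (intro exI[of _ 0]) simp
  next
    case (Suc t)
    then obtain p n where IH: "p + n = t" "\<sigma> 0 * \<gamma> ^ p \<le> \<sigma> t * \<gamma> ^ n" "gap t \<le> C ^ n * gap 0"
      by auto
    from step[of t] Suc.prems consider
        (up) "\<sigma> (Suc t) = \<gamma> * \<sigma> t" "gap (Suc t) \<le> gap t"
      | (down) "\<sigma> (Suc t) \<in> {\<sigma> t, \<sigma> t / \<gamma>}" "gap (Suc t) \<le> C * gap t"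
      by auto
    then show ?case
    proof cases
      case up
      then show ?thesis
        using IH \<open>\<gamma> > 1\<close> mult_left_mono[OF IH(2), of \<gamma>]
        by (intro exI[of _ "Suc p"] exI[of _ n]) (simp add: mult_ac)
    next
      case down
      have "\<sigma> t \<le> \<sigma> t * \<gamma>"
        using pos[of t] Suc.prems \<open>\<gamma> > 1\<close> by simp
      then have "\<sigma> t * \<gamma> ^ n \<le> \<sigma> (Suc t) * \<gamma> ^ Suc n"
        using down(1) \<open>\<gamma> > 1\<close> by (auto simp: mult_right_mono mult.assoc[symmetric])
      with IH(2) have "\<sigma> 0 * \<gamma> ^ p \<le> \<sigma> (Suc t) * \<gamma> ^ Suc n"
        by linarith
      moreover have "gap (Suc t) \<le> C ^ Suc n * gap 0"
        using order_trans[OF down(2) mult_left_mono[OF IH(3), of C]] \<open>C > 0\<close>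
        by (simp add: mult.assoc)
      ultimately show ?thesis
        using IH(1) by (intro exI[of _ p] exI[of _ "Suc n"]) simp
    qed
  qed
  then obtain p n where "p + n = N" and le: "\<sigma> 0 * \<gamma> ^ p \<le> \<sigma> N * \<gamma> ^ n"
    and gap: "gap N \<le> C ^ n * gap 0"
    by blast
  \<comment> \<open>Logarithms bound \<open>p\<close> by \<open>n\<close> plus the net growth of
    \<sigma> to base \<gamma>; the factor 2 in the claim comes from
    \<open>N = p + n\<close>.\<close>
  have "ln (\<sigma> 0 * \<gamma> ^ p) \<le> ln (\<sigma> N * \<gamma> ^ n)"
    using le assms(1,3) pos[of N] by (subst ln_le_cancel_iff) auto
  then have "real p * ln \<gamma> \<le> ln (\<sigma> N / \<sigma> 0) + real n * ln \<gamma>"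
    using assms(1,3) pos[of N] by (simp add: ln_mult ln_div ln_realpow)
  then have "real p \<le> ln (\<sigma> N / \<sigma> 0) / ln \<gamma> + real n"
    using assms(1) by (simp add: field_simps)
  with \<open>p + n = N\<close> have "real N \<le> 2 * real n + ln (\<sigma> N / \<sigma> 0) / ln \<gamma>"
    by linarith
  then show ?thesis
    using gap that by blast
qed

section \<open>The iteration bound\<close>

theorem theorem2:
  fixes f :: "real^'d \<Rightarrow> real"
    and A :: "real^'n^'d"
    and g :: "'n \<Rightarrow> real \<Rightarrow> ereal"
    and B :: "'k::finite \<Rightarrow> 'n set"
    and \<alpha> :: "nat \<Rightarrow> real^'n"
    and \<sigma> :: "nat \<Rightarrow> real"
    and \<alpha>star :: "real^'n"
    and \<tau> \<mu> \<gamma> \<zeta> \<xi> \<eta> \<sigma>sup :: real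
  defines "F \<equiv> objective f A g"
  defines "C\<^sub>2 \<equiv> 1 - \<xi> * (1 - \<eta>) * (\<mu> * \<tau> / (c_A A B * \<sigma>sup + \<mu> * \<tau>))"
  defines "\<epsilon>\<^sub>0 \<equiv> real_of_ereal (F (\<alpha> 0) - F \<alpha>star)"
  assumes f_convex: "convex_on UNIV f"
    and f_diff: "twice_differentiable f"
    and \<tau>_pos: "\<tau> > 0"
    and f_smooth: "(1 / \<tau>)-lipschitz_on UNIV (gradient f)"
    and \<mu>_pos: "\<mu> > 0"
    and g_strongly_convex: "\<And>i. strongly_convex \<mu> (g i)"
    and \<alpha>star_min: "is_arg_min F (\<lambda>_. True) \<alpha>star"
    and partition: "is_partition B"
    and parameters: "\<gamma> > 1" "\<zeta> > 1" "0 < \<xi>" "\<xi> < 1 / \<zeta>" "0 \<le> \<eta>" "\<eta> < 1"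
    and \<sigma>\<^sub>0_pos: "\<sigma> 0 > 0"
    and start_in_domain: "F (\<alpha> 0) < \<infinity>"
    and run: "adn_run f A g B \<gamma> \<zeta> \<xi> \<eta> \<alpha> \<sigma>"
    and \<sigma>_bounded: "\<And>t. \<sigma> t \<le> \<sigma>sup"
  shows "0 < C\<^sub>2 \<and> C\<^sub>2 < 1 \<and>
    (\<forall>\<epsilon>>0. \<exists>t.
       real t \<le> max 0 (1 / ln \<gamma> * ln (\<gamma> * (\<sigma>sup / \<sigma> 0)) + 2 / ln (1 / C\<^sub>2) * ln (\<epsilon>\<^sub>0 / \<epsilon>)) \<and>
       F (\<alpha> t) - F \<alpha>star \<le> ereal \<epsilon>)"
proof -
  let ?s = "\<mu> * \<tau> / (c_A A B * \<sigma>sup + \<mu> * \<tau>)"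
  let ?N_bound = "\<lambda>\<epsilon>. 1 / ln \<gamma> * ln (\<gamma> * (\<sigma>sup / \<sigma> 0)) + 2 / ln (1 / C\<^sub>2) * ln (\<epsilon>\<^sub>0 / \<epsilon>)"
  have \<sigma>sup: "\<sigma> 0 \<le> \<sigma>sup" "0 < \<sigma>sup"
    using \<sigma>_bounded[of 0] \<sigma>\<^sub>0_pos by auto
  have "0 < ?s" "?s \<le> 1"
    using c_A_nonneg[of A B] \<sigma>sup \<tau>_pos \<mu>_pos by (auto simp: add_nonneg_pos)
  have "\<xi> < 1"
    using parameters(2,4) less_trans[of \<xi> "1 / \<zeta>" 1] by simp
  have factor: "0 < \<xi> * (1 - \<eta>) * ?s" "\<xi> * (1 - \<eta>) * ?s < 1"
  proof -
    show "0 < \<xi> * (1 - \<eta>) * ?s"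
      using \<open>0 < ?s\<close> parameters(3,6) by (intro mult_pos_pos) auto
    have "\<xi> * (1 - \<eta>) * ?s \<le> \<xi> * 1 * 1"
      using \<open>0 < ?s\<close> \<open>?s \<le> 1\<close> parameters(3,5,6) by (intro mult_mono) auto
    then show "\<xi> * (1 - \<eta>) * ?s < 1"
      using \<open>\<xi> < 1\<close> by simp
  qed
  from factor have C: "0 < C\<^sub>2" "C\<^sub>2 < 1"
    by (simp_all add: C\<^sub>2_def)
  have \<sigma>_pos: "0 < \<sigma> t" for t
  proof (induction t)
    case (Suc t)
    have "adn_step f A g B \<gamma> \<zeta> \<xi> \<eta> (\<alpha> t) (\<sigma> t) (\<alpha> (Suc t)) (\<sigma> (Suc t))"
      using run by (simp add: adn_run_def)
    then have "\<sigma> (Suc t) \<in> {\<sigma> t / \<gamma>, \<sigma> t, \<gamma> * \<sigma> t}"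
      unfolding adn_step_def by (elim exE conjE) simp
    then show ?case
      using Suc parameters(1) by auto
  qed (rule \<sigma>\<^sub>0_pos)
  have not_minfty: "F x \<noteq> -\<infinity>" for x
    using sum_ereal_neq_minfty[of UNIV "\<lambda>i. g i (x $ i)", OF
        strongly_convex_neq_minfty[OF g_strongly_convex]] by (simp add: F_def objective_def)
  have F_min: "F \<alpha>star \<le> F x" for x
    using \<alpha>star_min by (auto simp: is_arg_min_def not_less)
  obtain a where a: "F (\<alpha> 0) = ereal a"
    using start_in_domain not_minfty[of "\<alpha> 0"] by (cases "F (\<alpha> 0)") auto
  obtain b where b: "F \<alpha>star = ereal b"
    using F_min[of "\<alpha> 0"] a not_minfty[of \<alpha>star] by (cases "F \<alpha>star") auto
  have \<epsilon>\<^sub>0: "\<epsilon>\<^sub>0 = a - b"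
    by (simp add: \<epsilon>\<^sub>0_def a b)
  have "\<exists>t. real t \<le> max 0 (?N_bound \<epsilon>) \<and> F (\<alpha> t) - F \<alpha>star \<le> ereal \<epsilon>" if "\<epsilon> > 0" for \<epsilon>
  \<comment> \<open>If the start is already good enough, \<open>t = 0\<close> works; the logarithm
    of \<open>\<epsilon>\<^sub>0 / \<epsilon>\<close> may then be negative, and the truncation at 0
    keeps the bound valid.\<close>
  proof (cases "\<epsilon>\<^sub>0 \<le> \<epsilon>")
    case True
    then show ?thesis
      by (intro exI[of _ 0]) (simp add: a b \<epsilon>\<^sub>0)
  next
    case False
    \<comment> \<open>This is the claimed bound without the factor \<gamma> inside the first
      logarithm. That factor contributes exactly 1, which pays for rounding \<open>E\<close> up to
      the integer \<open>N\<close>.\<close>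
    define E where "E = ln (\<sigma>sup / \<sigma> 0) / ln \<gamma> + 2 * ln (\<epsilon>\<^sub>0 / \<epsilon>) / ln (1 / C\<^sub>2)"
    define N where "N = nat \<lceil>E\<rceil>"
    have ln_pos: "0 < ln \<gamma>" "0 < ln (1 / C\<^sub>2)" "0 < ln (\<epsilon>\<^sub>0 / \<epsilon>)"
      using parameters(1) C False \<open>\<epsilon> > 0\<close> by (simp_all add: ln_gt_zero)
    have "0 \<le> E"
      unfolding E_def using ln_pos \<sigma>sup \<sigma>\<^sub>0_pos by (intro add_nonneg_nonneg divide_nonneg_pos ln_ge_zero) auto
    have "?N_bound \<epsilon> = 1 + E"
      unfolding E_def using ln_pos(1) \<sigma>sup \<sigma>\<^sub>0_pos parameters(1) ln_mult_pos[of \<gamma> "\<sigma>sup / \<sigma> 0"]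
      by (simp add: add_divide_distrib)
    moreover have "real N \<le> 1 + E" "E \<le> real N"
      using \<open>0 \<le> E\<close> unfolding N_def by linarith+
    ultimately have N: "real N \<le> ?N_bound \<epsilon>" "E \<le> real N"
      by (simp_all only:)
    show ?thesis
    \<comment> \<open>Either an optimal iterate occurs up to \<open>N\<close>, or the gap is nonzero
      throughout, as the one-step estimate requires.\<close>
    proof (cases "\<exists>t\<le>N. F (\<alpha> t) = F \<alpha>star")
      case True
      then obtain t where "t \<le> N" "F (\<alpha> t) = F \<alpha>star"
        by blast
      moreover from this(1) have "real t \<le> max 0 (?N_bound \<epsilon>)"
        by (intro max.coboundedI2 order_trans[OF _ N(1)]) simp
      ultimately show ?thesis
        using \<open>\<epsilon> > 0\<close> by (intro exI[of _ t]) (simp add: b)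
    next
      case suboptimal: False
      have progress: "\<exists>a'. F (\<alpha> (Suc t)) = ereal a' \<and> (\<sigma> (Suc t) = \<gamma> * \<sigma> t \<and> a' \<le> a \<or>
          \<sigma> (Suc t) \<in> {\<sigma> t, \<sigma> t / \<gamma>} \<and> a' - b \<le> C\<^sub>2 * (a - b))"
        if "F (\<alpha> t) = ereal a" and "t < N" for t a
      proof -
        have "b \<le> a"
          using F_min[of "\<alpha> t"] by (simp add: that(1) b)
        moreover have "b \<noteq> a"
          using suboptimal that by (auto simp: b)
        ultimately have less: "b < a"
          by simp
        have step: "adn_step f A g B \<gamma> \<zeta> \<xi> \<eta> (\<alpha> t) (\<sigma> t) (\<alpha> (Suc t)) (\<sigma> (Suc t))"
          using run by (simp add: adn_run_def)
        show ?thesis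
          unfolding F_def C\<^sub>2_def
          by (rule adn_step_progress[OF f_convex f_diff \<tau>_pos f_smooth \<mu>_pos g_strongly_convex
                partition parameters(2-4,6) step \<sigma>_pos \<sigma>_bounded that(1)[unfolded F_def]
                b[unfolded F_def] less]) (intro exI conjI)
      qed
      have finite: "\<exists>a. F (\<alpha> t) = ereal a" if "t \<le> N" for t
        using that
      proof (induction t)
        case (Suc t)
        then obtain a where "F (\<alpha> t) = ereal a"
          by auto
        from progress[OF this] Suc.prems show ?case
          by auto
      qed (simp add: a)
      \<comment> \<open>Up to \<open>N\<close> all values are finite, so the conversion to a real
        loses nothing there.\<close>
      define gap where "gap t = real_of_ereal (F (\<alpha> t)) - b" for t
      have step: "\<sigma> (Suc t) = \<gamma> * \<sigma> t \<and> gap (Suc t) \<le> gap t \<or>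
          \<sigma> (Suc t) \<in> {\<sigma> t, \<sigma> t / \<gamma>} \<and> gap (Suc t) \<le> C\<^sub>2 * gap t" if "t < N" for t
      proof -
        obtain a where a: "F (\<alpha> t) = ereal a"
          using finite[of t] \<open>t < N\<close> by auto
        from progress[OF this that] show ?thesis
          by (auto simp: gap_def a)
      qed
      obtain n where n: "real N \<le> 2 * real n + ln (\<sigma> N / \<sigma> 0) / ln \<gamma>" "gap N \<le> C\<^sub>2 ^ n * gap 0"
        by (rule contraction_count[where gap = gap and \<sigma> = \<sigma>, OF parameters(1) C(1) \<sigma>\<^sub>0_pos step \<sigma>_pos])
      have "ln (\<sigma> N / \<sigma> 0) / ln \<gamma> \<le> ln (\<sigma>sup / \<sigma> 0) / ln \<gamma>"
        using \<sigma>_bounded[of N] \<sigma>_pos[of N] \<sigma>sup \<sigma>\<^sub>0_pos ln_pos(1)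
        by (intro divide_right_mono ln_mono) simp_all
      \<comment> \<open>Both \<open>E\<close> and the bound on \<open>N\<close> contain a \<sigma>
        term; since \<open>\<sigma> N\<close> is at most \<open>\<sigma>sup\<close>, these drop out
        and enough contracting steps remain.\<close>
      with n(1) N(2) have "ln (\<epsilon>\<^sub>0 / \<epsilon>) / ln (1 / C\<^sub>2) \<le> real n"
        unfolding E_def by linarith
      then have "ln (\<epsilon>\<^sub>0 / \<epsilon>) \<le> real n * ln (1 / C\<^sub>2)"
        using ln_pos(2) by (simp only: pos_divide_le_eq)
      also have "\<dots> = ln ((1 / C\<^sub>2) ^ n)"
        using C by (simp add: ln_realpow)
      finally have "\<epsilon>\<^sub>0 / \<epsilon> \<le> (1 / C\<^sub>2) ^ n"
        using False \<open>\<epsilon> > 0\<close> C by (subst (asm) ln_le_cancel_iff) auto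
      then have "C\<^sub>2 ^ n * \<epsilon>\<^sub>0 \<le> \<epsilon>"
        using \<open>\<epsilon> > 0\<close> C by (simp add: power_one_over pos_divide_le_eq pos_le_divide_eq mult.commute)
      moreover have "gap 0 = \<epsilon>\<^sub>0"
        by (simp add: gap_def a \<epsilon>\<^sub>0)
      ultimately have "gap N \<le> \<epsilon>"
        using n(2) by simp
      moreover obtain a' where "F (\<alpha> N) = ereal a'"
        using finite[of N] by auto
      ultimately have "F (\<alpha> N) - F \<alpha>star \<le> ereal \<epsilon>"
        by (simp add: gap_def b)
      then show ?thesis
        using N(1) by (intro exI[of _ N]) simp
    qed
  qed
  with C show ?thesis
    by blast
qed

end
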